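(* Let $n\geq 4$. (a) The maximal order of a critical group of an arithmetical structure on $D_n$ is $2n-5$, and there is a unique arithmetical structure on $D_n$ whose critical group has order $2n-5$. (b) The maximal even order of a critical group of an arithmetical structure on $D_n$ is $6k-4$ if $n=4k$ or $n=4k+1$, and $6k-2$ if $n=4k+2$ or $n=4k+3$ (for integers $k$).
   Context: For $n\ge 3$ let $\ell=n-3$. The bident $D_n$ is the graph with vertices $v_x,v_y,v_0,v_1,\dots,v_\ell$ and edges $v_xv_0$, $v_yv_0$, and $v_iv_{i+1}$ for $0\le i\le \ell-1$. For a finite connected graph $G$ with $n$ vertices and adjacency matrix $A$, an arithmetical structure on $G$ is a pair $(\mathbf d,\mathbf r)$ of vectors with positive integer entries indexed by the vertices such that $(\operatorname{diag}(\mathbf d)-A)\mathbf r=\mathbf 0$ and the entries of $\mathbf r$ have no nontrivial common factor. The cokernel $\mathbb Z^n/\operatorname{Im}(\operatorname{diag}(\mathbf d)-A)$ is isomorphic to $\mathbb Z\oplus K$ for a finite abelian group $K$; this torsion part $K=\mathcal K(G;\mathbf d,\mathbf r)$ is the critical group of the arithmetical structure. *)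

theory Defs
  imports "HOL-Algebra.Algebra"
begin

type_synonym 'a graph = "'a set \<times> 'a set set"

abbreviation vertices :: "'a graph \<Rightarrow> 'a set" where
  "vertices G \<equiv> fst G"

abbreviation edges :: "'a graph \<Rightarrow> 'a set set" where
  "edges G \<equiv> snd G"

definition finite_connected_graph :: "'a graph \<Rightarrow> bool" where
  "finite_connected_graph G \<longleftrightarrow>
     finite (vertices G) \<and> vertices G \<noteq> {} \<and>
     (\<forall>e\<in>edges G. e \<subseteq> vertices G \<and> card e = 2) \<and>
     (\<forall>u\<in>vertices G. \<forall>v\<in>vertices G. (u, v) \<in> {(a, b). {a, b} \<in> edges G}\<^sup>*)"

definition adjacency_matrix :: "'a graph \<Rightarrow> 'a \<Rightarrow> 'a \<Rightarrow> int" where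
  "adjacency_matrix G u v = (if {u, v} \<in> edges G then 1 else 0)"

definition diag_matrix :: "('a \<Rightarrow> int) \<Rightarrow> 'a \<Rightarrow> 'a \<Rightarrow> int" where
  "diag_matrix d u v = (if u = v then d u else 0)"

definition mat_vec :: "'a set \<Rightarrow> ('a \<Rightarrow> 'a \<Rightarrow> int) \<Rightarrow> ('a \<Rightarrow> int) \<Rightarrow> 'a \<Rightarrow> int" where
  "mat_vec V M y = (\<lambda>u\<in>V. \<Sum>v\<in>V. M u v * y v)"

definition generalized_laplacian :: "'a graph \<Rightarrow> ('a \<Rightarrow> int) \<Rightarrow> 'a \<Rightarrow> 'a \<Rightarrow> int" where
  "generalized_laplacian G d u v = diag_matrix d u v - adjacency_matrix G u v"

text \<open>Vectors are extensional functions on the vertex set, so that equality of pairs is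
  equality of arithmetical structures.\<close>

definition arithmetical_structures :: "'a graph \<Rightarrow> (('a \<Rightarrow> int) \<times> ('a \<Rightarrow> int)) set" where
  "arithmetical_structures G =
     {(d, r). d \<in> vertices G \<rightarrow>\<^sub>E {0<..} \<and> r \<in> vertices G \<rightarrow>\<^sub>E {0<..} \<and>
        mat_vec (vertices G) (generalized_laplacian G d) r = (\<lambda>u\<in>vertices G. 0) \<and>
        Gcd (r ` vertices G) = 1}"

abbreviation integer_vectors :: "'a set \<Rightarrow> ('a \<Rightarrow> int) monoid" where
  "integer_vectors V \<equiv> product_group V (\<lambda>_. integer_group)"

definition cokernel :: "'a set \<Rightarrow> ('a \<Rightarrow> 'a \<Rightarrow> int) \<Rightarrow> ('a \<Rightarrow> int) set monoid" where
  "cokernel V M = integer_vectors V Mod (mat_vec V M ` carrier (integer_vectors V))"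

definition torsion_part :: "('a, 'b) monoid_scheme \<Rightarrow> ('a, 'b) monoid_scheme" where
  "torsion_part H =
     H\<lparr>carrier := {x \<in> carrier H. \<exists>m::nat. m > 0 \<and> x [^]\<^bsub>H\<^esub> m = \<one>\<^bsub>H\<^esub>}\<rparr>"

definition critical_group ::
  "'a graph \<Rightarrow> ('a \<Rightarrow> int) \<times> ('a \<Rightarrow> int) \<Rightarrow> ('a \<Rightarrow> int) set monoid" where
  "critical_group G S = torsion_part (cokernel (vertices G) (generalized_laplacian G (fst S)))"

definition critical_group_orders :: "'a graph \<Rightarrow> nat set" where
  "critical_group_orders G = {order (critical_group G S) | S. S \<in> arithmetical_structures G}"

datatype bident_vertex = V_x | V_y | V_path nat

definition bident :: "nat \<Rightarrow> bident_vertex graph" where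
  "bident n =
     ({V_x, V_y} \<union> V_path ` {0..n - 3},
      {{V_x, V_path 0}, {V_y, V_path 0}} \<union> {{V_path i, V_path (i + 1)} | i. i < n - 3})"

definition is_maximum :: "nat set \<Rightarrow> nat \<Rightarrow> bool" where
  "is_maximum S m \<longleftrightarrow> m \<in> S \<and> (\<forall>x\<in>S. x \<le> m)"

lemma card_bident_vertices:
  assumes "n \<ge> 3"
  shows "card (vertices (bident n)) = n"
proof -
  have "card (V_path ` {0..n - 3}) = n - 2"
    using assms by (subst card_image) (auto simp: inj_on_def)
  moreover have "V_x \<notin> V_path ` {0..n - 3}" "V_y \<notin> V_path ` {0..n - 3}"
    by auto
  ultimately show ?thesis
    using assms by (simp add: bident_def)
qed

lemma finite_connected_graph_bident: "finite_connected_graph (bident n)"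
proof -
  let ?R = "{(a, b). {a, b} \<in> edges (bident n)}"
  have "sym ?R"
    by (auto simp: sym_def insert_commute)
  then have sym: "sym (?R\<^sup>*)"
    by (rule sym_rtrancl)
  have path: "(V_path 0, V_path i) \<in> ?R\<^sup>*" if "i \<le> n - 3" for i
    using that
  proof (induction i)
    case (Suc i)
    then have "(V_path i, V_path (Suc i)) \<in> ?R"
      by (auto simp: bident_def)
    with Suc show ?case
      by (meson Suc_leD rtrancl.rtrancl_into_rtrancl)
  qed simp
  have "(V_path 0, V_x) \<in> ?R" "(V_path 0, V_y) \<in> ?R"
    by (auto simp: bident_def insert_commute)
  with path have "(V_path 0, v) \<in> ?R\<^sup>*" if "v \<in> vertices (bident n)" for v
    using that by (auto simp: bident_def)
  then have "(u, v) \<in> ?R\<^sup>*" if "u \<in> vertices (bident n)" "v \<in> vertices (bident n)" for u v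
    using that sym by (meson rtrancl_trans symD)
  moreover have "e \<subseteq> vertices (bident n) \<and> card e = 2" if "e \<in> edges (bident n)" for e
    using that by (auto simp: bident_def)
  ultimately show ?thesis
    unfolding finite_connected_graph_def by (simp add: bident_def)
qed

text \<open>Since \<^term>\<open>order\<close> is \<open>0\<close> on infinite groups, we check that critical groups are finite.\<close>

lemma bounded_torsion_exponent:
  fixes H :: "('a \<Rightarrow> int) set"
  assumes "finite W"
    and "(\<lambda>_. 0) \<in> H"
    and "\<And>x y a b. x \<in> H \<Longrightarrow> y \<in> H \<Longrightarrow> (\<lambda>v. a * x v + b * y v) \<in> H"
    and "\<And>h v. h \<in> H \<Longrightarrow> v \<notin> W \<Longrightarrow> h v = 0"
  shows "\<exists>e>0. \<forall>x m. m > 0 \<longrightarrow> (\<lambda>v. m * x v) \<in> H \<longrightarrow> (\<lambda>v. e * x v) \<in> H"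
  using assms
proof (induction W arbitrary: H rule: finite_induct)
  case empty
  have "(\<lambda>v. 1 * x v) \<in> H" if "m > 0" "(\<lambda>v. m * x v) \<in> H" for m :: int and x
  proof -
    have "x v = 0" for v
      using empty.prems(3)[OF that(2), of v] that(1) by simp
    then have "x = (\<lambda>_. 0)" by auto
    then show ?thesis using empty.prems(1) by simp
  qed
  then show ?case by (intro exI[of _ 1]) auto
next
  case (insert w W)
  define H0 where "H0 = {h \<in> H. h w = 0}"
  have "\<exists>e>0. \<forall>x m. m > 0 \<longrightarrow> (\<lambda>v. m * x v) \<in> H0 \<longrightarrow> (\<lambda>v. e * x v) \<in> H0"
  proof (rule insert.IH)
    show "h v = 0" if "h \<in> H0" "v \<notin> W" for h v
      using that insert.prems(3)[of h v] by (cases "v = w") (auto simp: H0_def)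
  qed (use insert.prems(1,2) in \<open>auto simp: H0_def\<close>)
  then obtain e0 :: int where e0: "e0 > 0"
    and e0': "\<And>x m. m > 0 \<Longrightarrow> (\<lambda>v. m * x v) \<in> H0 \<Longrightarrow> (\<lambda>v. e0 * x v) \<in> H0"
    by blast
  show ?case
  proof (cases "H = H0")
    case True
    with e0 e0' show ?thesis by blast
  next
    case False
    then obtain h0 where h0: "h0 \<in> H" "h0 w \<noteq> 0"
      by (auto simp: H0_def)
    define h where "h = (\<lambda>v. sgn (h0 w) * h0 v + 0 * h0 v)"
    have h: "h \<in> H" "h w > 0"
      unfolding h_def using insert.prems(2)[OF h0(1) h0(1)] h0(2) by (blast, simp add: sgn_if)
    have "(\<lambda>v. e0 * h w * x v) \<in> H" if "m > 0" "(\<lambda>v. m * x v) \<in> H" for x m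
    proof -
      define y where "y = (\<lambda>v. h w * x v - x w * h v)"
      have "(\<lambda>v. m * y v) = (\<lambda>v. h w * (m * x v) + (- m * x w) * h v)"
        by (auto simp: y_def algebra_simps)
      then have "(\<lambda>v. m * y v) \<in> H"
        by (simp only: insert.prems(2)[OF that(2) h(1)])
      then have "(\<lambda>v. m * y v) \<in> H0"
        by (simp add: H0_def y_def)
      then have "(\<lambda>v. e0 * y v) \<in> H"
        using e0'[OF that(1)] by (simp add: H0_def)
      from insert.prems(2)[OF this h(1), of 1 "e0 * x w"] show ?thesis
        by (simp add: y_def algebra_simps)
    qed
    then show ?thesis
      using e0 h(2) by (intro exI[of _ "e0 * h w"]) auto
  qed
qed

lemma mat_vec_lincomb:
  "u \<in> V \<Longrightarrow> mat_vec V M (\<lambda>v\<in>V. a * y v + b * z v) u = a * mat_vec V M y u + b * mat_vec V M z u"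
  by (simp add: mat_vec_def sum_distrib_left sum.distrib algebra_simps)

lemma comm_group_integer_vectors: "comm_group (integer_vectors V)"
proof -
  interpret group "integer_vectors V" by simp
  show ?thesis
    by (rule group_comm_groupI) (auto simp: add.commute fun_eq_iff restrict_def)
qed

lemma inv_integer_vectors:
  assumes "x \<in> carrier (integer_vectors V)"
  shows "inv\<^bsub>integer_vectors V\<^esub> x = (\<lambda>v\<in>V. - x v)"
  using assms by (subst inv_product_group) auto

lemma nat_pow_integer_vectors:
  assumes "x \<in> carrier (integer_vectors V)"
  shows "x [^]\<^bsub>integer_vectors V\<^esub> (m::nat) = (\<lambda>v\<in>V. int m * x v)"
proof (induction m)
  case (Suc m)
  then show ?case by (auto simp: algebra_simps fun_eq_iff)
qed auto

lemma normal_image_mat_vec: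
  "mat_vec V M ` carrier (integer_vectors V) \<lhd> integer_vectors V"
proof -
  interpret comm_group "integer_vectors V" by (rule comm_group_integer_vectors)
  let ?I = "mat_vec V M ` carrier (integer_vectors V)"
  have "subgroup ?I (integer_vectors V)"
  proof (rule subgroupI)
    show "?I \<subseteq> carrier (integer_vectors V)"
      by (auto simp: mat_vec_def)
    show "?I \<noteq> {}"
      by (metis empty_iff imageI one_closed)
    fix a assume "a \<in> ?I"
    then obtain y where y: "y \<in> carrier (integer_vectors V)" "a = mat_vec V M y" by blast
    have "inv\<^bsub>integer_vectors V\<^esub> a = mat_vec V M (\<lambda>v\<in>V. (-1) * y v + 0 * y v)"
      unfolding y(2) by (subst inv_integer_vectors) (auto simp: fun_eq_iff mat_vec_def sum_negf)
    then show "inv\<^bsub>integer_vectors V\<^esub> a \<in> ?I"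
      by auto
    fix b assume "b \<in> ?I"
    then obtain z where z: "z \<in> carrier (integer_vectors V)" "b = mat_vec V M z" by blast
    have "a \<otimes>\<^bsub>integer_vectors V\<^esub> b = mat_vec V M (\<lambda>v\<in>V. 1 * y v + 1 * z v)"
      using y z by (auto simp: fun_eq_iff mat_vec_def sum.distrib algebra_simps)
    then show "a \<otimes>\<^bsub>integer_vectors V\<^esub> b \<in> ?I"
      by auto
  qed
  then show ?thesis
    by (simp add: normal_iff_subgroup)
qed

lemma finite_torsion_part_cokernel:
  assumes "finite V"
  shows "finite (carrier (torsion_part (cokernel V M)))"
proof -
  let ?Z = "integer_vectors V"
  let ?I = "mat_vec V M ` carrier ?Z"
  let ?K = "carrier (torsion_part (cokernel V M))"
  interpret comm_group ?Z by (rule comm_group_integer_vectors)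
  interpret N: normal ?I ?Z by (rule normal_image_mat_vec)
  define H where "H = {h. (\<forall>v. v \<notin> V \<longrightarrow> h v = 0) \<and> restrict h V \<in> ?I}"
  have "\<exists>e>0. \<forall>x m. m > 0 \<longrightarrow> (\<lambda>v. m * x v) \<in> H \<longrightarrow> (\<lambda>v. e * x v) \<in> H"
  proof (rule bounded_torsion_exponent[OF assms])
    have "(\<lambda>v\<in>V. 0) \<in> ?I"
      using N.one_closed by simp
    then show "(\<lambda>_. 0) \<in> H"
      by (simp add: H_def)
    fix x y :: "'a \<Rightarrow> int" and a b :: int
    assume "x \<in> H" "y \<in> H"
    then obtain x' y' where
      *: "restrict x V = mat_vec V M x'" "restrict y V = mat_vec V M y'"
         "\<And>v. v \<notin> V \<Longrightarrow> x v = 0" "\<And>v. v \<notin> V \<Longrightarrow> y v = 0"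
      by (auto simp: H_def)
    have "restrict (\<lambda>v. a * x v + b * y v) V = mat_vec V M (\<lambda>v\<in>V. a * x' v + b * y' v)"
    proof
      fix u
      show "restrict (\<lambda>v. a * x v + b * y v) V u = mat_vec V M (\<lambda>v\<in>V. a * x' v + b * y' v) u"
      proof (cases "u \<in> V")
        case True
        then have "x u = mat_vec V M x' u" "y u = mat_vec V M y' u"
          using *(1,2) by (metis restrict_apply')+
        with True show ?thesis by (simp add: mat_vec_lincomb)
      qed (simp add: mat_vec_def)
    qed
    with * show "(\<lambda>v. a * x v + b * y v) \<in> H"
      by (auto simp: H_def)
  qed (auto simp: H_def)
  then obtain e :: int where e: "e > 0"
    and tors: "\<And>x m. m > 0 \<Longrightarrow> (\<lambda>v. m * x v) \<in> H \<Longrightarrow> (\<lambda>v. e * x v) \<in> H"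
    by blast
  have pow: "(?I #>\<^bsub>?Z\<^esub> x) [^]\<^bsub>cokernel V M\<^esub> (m::nat) = ?I #>\<^bsub>?Z\<^esub> (x [^]\<^bsub>?Z\<^esub> m)"
    if "x \<in> carrier ?Z" for x m
    using N.FactGroup_pow that unfolding cokernel_def by blast
  have ex: "\<exists>x. x \<in> carrier ?Z \<and> C = ?I #>\<^bsub>?Z\<^esub> x \<and> (\<exists>m::nat. m > 0 \<and> (\<lambda>v\<in>V. int m * x v) \<in> ?I)"
    if "C \<in> ?K" for C
  proof -
    from that obtain x m where x: "x \<in> carrier ?Z" "C = ?I #>\<^bsub>?Z\<^esub> x"
      and m: "(m::nat) > 0" "C [^]\<^bsub>cokernel V M\<^esub> m = \<one>\<^bsub>cokernel V M\<^esub>"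
      unfolding torsion_part_def by (auto simp: cokernel_def FactGroup_def RCOSETS_def)
    have "?I #>\<^bsub>?Z\<^esub> (x [^]\<^bsub>?Z\<^esub> m) = ?I"
      using m(2) pow[OF x(1)] x(2) by (simp add: cokernel_def FactGroup_def)
    then have "x [^]\<^bsub>?Z\<^esub> m \<in> ?I"
      using x(1) by (metis N.subgroup_axioms nat_pow_closed rcos_self)
    then show ?thesis
      using x m(1) nat_pow_integer_vectors[OF x(1)] by auto
  qed
  then obtain rep where rep: "\<And>C. C \<in> ?K \<Longrightarrow> rep C \<in> carrier ?Z"
    "\<And>C. C \<in> ?K \<Longrightarrow> C = ?I #>\<^bsub>?Z\<^esub> rep C"
    "\<And>C. C \<in> ?K \<Longrightarrow> \<exists>m::nat. m > 0 \<and> (\<lambda>v\<in>V. int m * rep C v) \<in> ?I"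
    by metis
  have "inj_on (\<lambda>C. \<lambda>v\<in>V. rep C v mod e) ?K"
  proof (rule inj_onI)
    fix C D
    assume C: "C \<in> ?K" and D: "D \<in> ?K"
      and eq: "(\<lambda>v\<in>V. rep C v mod e) = (\<lambda>v\<in>V. rep D v mod e)"
    define z where "z = (\<lambda>v. if v \<in> V then (rep C v - rep D v) div e else 0)"
    have z: "rep C v - rep D v = e * z v" if "v \<in> V" for v
    proof -
      have "rep C v mod e = rep D v mod e"
        using eq that by (metis restrict_apply')
      then show ?thesis
        using that by (simp add: z_def mod_eq_dvd_iff)
    qed
    obtain k l :: nat where k: "k > 0" "(\<lambda>v\<in>V. int k * rep C v) \<in> ?I"
      and l: "l > 0" "(\<lambda>v\<in>V. int l * rep D v) \<in> ?I"
      using rep(3) C D by meson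
    have "(\<lambda>v\<in>V. int l * (int k * rep C v)) \<in> ?I" "(\<lambda>v\<in>V. int k * (int l * rep D v)) \<in> ?I"
    proof -
      have *: "(\<lambda>v\<in>V. int p * w v) \<in> ?I" if "(\<lambda>v\<in>V. w v) \<in> ?I" for w and p :: nat
      proof -
        obtain w' where w': "w' \<in> carrier ?Z" "restrict w V = mat_vec V M w'"
          using \<open>(\<lambda>v\<in>V. w v) \<in> ?I\<close> by auto
        have "(\<lambda>v\<in>V. int p * w v) = mat_vec V M (\<lambda>v\<in>V. int p * w' v + 0 * w' v)"
        proof
          fix u
          show "(\<lambda>v\<in>V. int p * w v) u = mat_vec V M (\<lambda>v\<in>V. int p * w' v + 0 * w' v) u"
          proof (cases "u \<in> V")
            case True
            have "w u = mat_vec V M w' u"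
              using w'(2) True by (metis restrict_apply')
            with True show ?thesis
              by (subst mat_vec_lincomb) auto
          qed (simp add: mat_vec_def)
        qed
        then show ?thesis by auto
      qed
      show "(\<lambda>v\<in>V. int l * (int k * rep C v)) \<in> ?I" using *[OF k(2)] .
      show "(\<lambda>v\<in>V. int k * (int l * rep D v)) \<in> ?I" using *[OF l(2)] .
    qed
    then have "(\<lambda>v\<in>V. int l * (int k * rep C v)) \<otimes>\<^bsub>?Z\<^esub>
        inv\<^bsub>?Z\<^esub> (\<lambda>v\<in>V. int k * (int l * rep D v)) \<in> ?I"
      by (intro N.m_closed N.m_inv_closed)
    moreover have "(\<lambda>v\<in>V. int l * (int k * rep C v)) \<otimes>\<^bsub>?Z\<^esub>
        inv\<^bsub>?Z\<^esub> (\<lambda>v\<in>V. int k * (int l * rep D v)) = (\<lambda>v\<in>V. int l * int k * e * z v)"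
    proof
      fix v
      have "int l * (int k * rep C v) - int k * (int l * rep D v) = int l * int k * e * z v"
        if "v \<in> V"
        using z[OF that] by (simp add: mult.assoc flip: z[OF that]) (simp add: algebra_simps)
      then show "((\<lambda>v\<in>V. int l * (int k * rep C v)) \<otimes>\<^bsub>?Z\<^esub>
        inv\<^bsub>?Z\<^esub> (\<lambda>v\<in>V. int k * (int l * rep D v))) v = (\<lambda>v\<in>V. int l * int k * e * z v) v"
        by (subst inv_integer_vectors) auto
    qed
    ultimately have "(\<lambda>v. (int l * int k * e) * z v) \<in> H"
      by (simp add: H_def z_def)
    then have "(\<lambda>v. e * z v) \<in> H"
      using tors[of "int l * int k * e" z] k(1) l(1) e by simp
    then have "(\<lambda>v\<in>V. e * z v) \<in> ?I"
      by (simp add: H_def)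
    moreover have "rep C \<otimes>\<^bsub>?Z\<^esub> inv\<^bsub>?Z\<^esub> rep D = (\<lambda>v\<in>V. e * z v)"
      using z by (subst inv_integer_vectors[OF rep(1)[OF D]]) (auto simp: fun_eq_iff)
    ultimately have "rep C \<in> ?I #>\<^bsub>?Z\<^esub> rep D"
      using rep(1) C D N.rcos_module_rev[OF is_group, of "rep D" "rep C"] by simp
    then show "C = D"
      using rep(1,2) C D by (metis repr_independence N.subgroup_axioms)
  qed
  moreover have "(\<lambda>C. \<lambda>v\<in>V. rep C v mod e) ` ?K \<subseteq> (V \<rightarrow>\<^sub>E {0..<e})"
    using e by auto
  moreover have "finite (V \<rightarrow>\<^sub>E {0..<e})"
    using assms by (intro finite_PiE) auto
  ultimately show ?thesis
    using inj_on_finite by blast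
qed

corollary finite_critical_group:
  assumes "finite_connected_graph G"
  shows "finite (carrier (critical_group G S))"
  using assms by (simp add: critical_group_def finite_connected_graph_def finite_torsion_part_cokernel)

end

theory Submission
  imports Defs
begin

text \<open>
  Write \<open>x\<close>, \<open>y\<close> for the values of \<open>r\<close> at the two leaves, \<open>c\<^sub>0, \<dots>, c\<^sub>l\<close> with \<open>l = n - 3\<close> for its
  values along the path, and \<open>g = c\<^sub>l\<close>. Then \<open>x\<close>, \<open>y\<close>, \<open>g\<close> are pairwise coprime divisors of
  \<open>c\<^sub>0\<close>, and the critical group has order \<open>K = c\<^sub>0 / (x y g)\<close>: the torsion of the cokernel is the
  orthogonal complement of \<open>r\<close> modulo the image, on which \<open>z \<mapsto> (z\<^sub>x - z\<^sub>y) / g\<close> is onto the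
  integers, with the image being the preimage of \<open>K\<int>\<close>. Going along the path, \<open>r\<close> decreases by
  at most \<open>x + y\<close> at each step, up to vertices that can be contracted, so
  \<open>K x y g \<le> g + l (x + y)\<close>. This gives \<open>K \<le> 2 l + 1\<close>, with equality only for \<open>x = y = g = 1\<close>
  and a path of constant decrease \<open>2\<close>. If \<open>K\<close> is even then \<open>x = y = 1\<close> forces \<open>g = 2\<close>,
  and the largest even values come from \<open>{x, y} = {1, 2}\<close>, \<open>g = 1\<close>, where \<open>3\<close> cannot divide \<open>K\<close>.
\<close>

section \<open>The Laplacian of the bident\<close>

lemma mat_vec_generalized_laplacian:
  assumes "finite (vertices G)" and "u \<in> vertices G" and "{u} \<notin> edges G"
  shows "mat_vec (vertices G) (generalized_laplacian G d) w u =
    d u * w u - (\<Sum>v\<in>{v \<in> vertices G. {u, v} \<in> edges G}. w v)"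
proof -
  have "mat_vec (vertices G) (generalized_laplacian G d) w u =
    (\<Sum>v\<in>vertices G. (if v = u then d u * w u else 0) - (if {u, v} \<in> edges G then w v else 0))"
    using assms(2)
    by (auto simp: mat_vec_def generalized_laplacian_def diag_matrix_def adjacency_matrix_def
        algebra_simps intro!: sum.cong)
  also have "\<dots> = d u * w u - (\<Sum>v\<in>{v \<in> vertices G. {u, v} \<in> edges G}. w v)"
    using assms by (simp add: sum_subtractf sum.inter_filter)
  finally show ?thesis .
qed

text \<open>For \<open>r\<close> in the kernel of \<open>M\<close> this puts the image of
  \<open>M\<close> into the orthogonal complement of \<open>r\<close>.\<close>

lemma sum_mult_mat_vec_symmetric:
  assumes "finite V" and "\<And>u v. M u v = M v u"
  shows "(\<Sum>u\<in>V. r u * mat_vec V M w u) = (\<Sum>u\<in>V. w u * mat_vec V M r u)"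
proof -
  have "(\<Sum>u\<in>V. r u * mat_vec V M w u) = (\<Sum>u\<in>V. \<Sum>v\<in>V. r u * (M u v * w v))"
    by (simp add: mat_vec_def sum_distrib_left)
  also have "\<dots> = (\<Sum>v\<in>V. \<Sum>u\<in>V. r u * (M u v * w v))"
    by (rule sum.swap)
  also have "\<dots> = (\<Sum>v\<in>V. w v * mat_vec V M r v)"
    using assms(2) by (simp add: mat_vec_def sum_distrib_left mult_ac)
  finally show ?thesis .
qed

lemma vertices_bident: "vertices (bident n) = insert V_x (insert V_y (V_path ` {0..n - 3}))"
  by (auto simp: bident_def)

lemma finite_vertices_bident: "finite (vertices (bident n))"
  by (simp add: vertices_bident)

lemma bident_no_loop: "{u} \<notin> edges (bident n)"
  using finite_connected_graph_bident[of n] by (force simp: finite_connected_graph_def)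

lemma sum_vertices_bident:
  "(\<Sum>v\<in>vertices (bident n). f v) = f V_x + f V_y + (\<Sum>i\<le>n - 3. f (V_path i))"
proof -
  have "(\<Sum>v\<in>V_path ` {0..n - 3}. f v) = (\<Sum>i\<le>n - 3. f (V_path i))"
    by (subst sum.reindex) (auto simp: inj_on_def atLeast0AtMost)
  moreover have "V_x \<notin> V_path ` {0..n - 3}" "V_y \<notin> V_path ` {0..n - 3}"
    by auto
  ultimately show ?thesis
    by (simp add: vertices_bident add.assoc)
qed

lemma bident_laplacian_leaves:
  shows "mat_vec (vertices (bident n)) (generalized_laplacian (bident n) d) w V_x =
      d V_x * w V_x - w (V_path 0)"
    and "mat_vec (vertices (bident n)) (generalized_laplacian (bident n) d) w V_y =
      d V_y * w V_y - w (V_path 0)"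
proof -
  have "{v \<in> vertices (bident n). {V_x, v} \<in> edges (bident n)} = {V_path 0}"
    "{v \<in> vertices (bident n). {V_y, v} \<in> edges (bident n)} = {V_path 0}"
    by (auto simp: bident_def doubleton_eq_iff)
  moreover have "V_x \<in> vertices (bident n)" "V_y \<in> vertices (bident n)"
    by (simp_all add: vertices_bident)
  ultimately show "mat_vec (vertices (bident n)) (generalized_laplacian (bident n) d) w V_x =
      d V_x * w V_x - w (V_path 0)"
    and "mat_vec (vertices (bident n)) (generalized_laplacian (bident n) d) w V_y =
      d V_y * w V_y - w (V_path 0)"
    by (simp_all add: mat_vec_generalized_laplacian finite_vertices_bident bident_no_loop)
qed

lemma bident_laplacian_center:
  assumes "n \<ge> 4"
  shows "mat_vec (vertices (bident n)) (generalized_laplacian (bident n) d) w (V_path 0) =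
      d (V_path 0) * w (V_path 0) - w V_x - w V_y - w (V_path 1)"
proof -
  have "{v \<in> vertices (bident n). {V_path 0, v} \<in> edges (bident n)} = {V_x, V_y, V_path 1}"
    using assms by (auto simp: bident_def doubleton_eq_iff)
  moreover have "V_path 0 \<in> vertices (bident n)"
    by (simp add: vertices_bident)
  ultimately show ?thesis
    by (simp add: mat_vec_generalized_laplacian finite_vertices_bident bident_no_loop)
qed

lemma bident_laplacian_path:
  assumes "0 < i" "i \<le> n - 3"
  shows "mat_vec (vertices (bident n)) (generalized_laplacian (bident n) d) w (V_path i) =
      d (V_path i) * w (V_path i) - w (V_path (i - 1)) - (if i < n - 3 then w (V_path (i + 1)) else 0)"
proof -
  have "{v \<in> vertices (bident n). {V_path i, v} \<in> edges (bident n)} =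
    (if i < n - 3 then {V_path (i - 1), V_path (i + 1)} else {V_path (i - 1)})"
  proof -
    obtain j where "i = Suc j"
      using assms(1) by (cases i) auto
    with assms show ?thesis
      by (auto simp: bident_def doubleton_eq_iff)
  qed
  moreover have "V_path i \<in> vertices (bident n)"
    using assms by (simp add: vertices_bident)
  ultimately show ?thesis
    by (simp add: mat_vec_generalized_laplacian finite_vertices_bident bident_no_loop)
qed

section \<open>Divisibility chains\<close>

text \<open>A vertex whose value is the sum of its neighbours' values can be deleted, which shortens
  the chain and keeps \<open>S\<close>; without such vertices the consecutive differences do not increase.\<close>

lemma chain_bound:
  fixes c :: "nat \<Rightarrow> int"
  assumes "\<And>i. i \<le> l \<Longrightarrow> c i > 0" and "c (l + 1) = 0" and "S > 0" and "c 0 dvd c 1 + S"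
    and "\<And>i. 0 < i \<Longrightarrow> i \<le> l \<Longrightarrow> c i dvd c (i - 1) + c (i + 1)"
  shows "c 0 \<le> c l + int l * S \<and>
    (c 0 = c l + int l * S \<longrightarrow> (\<forall>i\<le>l. c i = c l + int (l - i) * S))"
  using assms
proof (induction l arbitrary: c)
  case 0
  then show ?case by simp
next
  case (Suc l)
  show ?case
  proof (cases "\<exists>j. 0 < j \<and> j \<le> Suc l \<and> c j = c (j - 1) + c (j + 1)")
    case True
    then obtain j where j: "0 < j" "j \<le> Suc l" "c j = c (j - 1) + c (j + 1)"
      by blast
    \<comment> \<open>\<open>c'\<close> is the chain with index \<open>j\<close> deleted. Since
      \<open>c j\<close> is the sum of its two neighbours, replacing it by the far one changes the
      sum at either neighbour by a multiple of that neighbour's own value. For \<open>j = 1\<close>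
      the same holds for \<open>c 1 + S\<close> modulo \<open>c 0\<close>.\<close>
    define c' where "c' i = (if i < j then c i else c (i + 1))" for i
    have "c' 0 \<le> c' l + int l * S \<and>
      (c' 0 = c' l + int l * S \<longrightarrow> (\<forall>i\<le>l. c' i = c' l + int (l - i) * S))"
    proof (rule Suc.IH)
      show "c' i > 0" if "i \<le> l" for i
        using that Suc.prems(1) by (simp add: c'_def)
      show "c' (l + 1) = 0"
        using Suc.prems(2) j by (simp add: c'_def)
      show "c' 0 dvd c' 1 + S"
      proof (cases "j = 1")
        case True
        have eq: "c 1 + S = (c 2 + S) + c 0"
          using j True by (simp add: numeral_2_eq_2)
        have "c 0 dvd c 2 + S"
          using Suc.prems(4) unfolding eq by simp
        then show ?thesis using True by (simp add: c'_def numeral_2_eq_2)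
      qed (use j Suc.prems(4) in \<open>auto simp: c'_def\<close>)
      fix i assume i: "0 < i" "i \<le> l"
      consider "i + 1 < j" | "i + 1 = j" | "i = j" | "i > j" by linarith
      then show "c' i dvd c' (i - 1) + c' (i + 1)"
      proof cases
        case 1
        then show ?thesis using Suc.prems(5)[of i] i by (simp add: c'_def)
      next
        case 2
        have "c i dvd c (i - 1) + c (i + 1)" using Suc.prems(5)[of i] i by simp
        moreover have eq: "c (i - 1) + c (i + 1) = c (i - 1) + c (i + 2) + c i"
          using j(3) unfolding 2[symmetric] by simp
        ultimately have "c i dvd c (i - 1) + c (i + 2)"
          unfolding eq by (simp only: dvd_add_left_iff dvd_refl)
        then show ?thesis using 2 by (auto simp: c'_def)
      next
        case 3
        have "c (i + 1) dvd c i + c (i + 2)" using Suc.prems(5)[of "i + 1"] i by simp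
        moreover have eq: "c i + c (i + 2) = c (i - 1) + c (i + 2) + c (i + 1)"
          using j 3 by simp
        ultimately have "c (i + 1) dvd c (i - 1) + c (i + 2)"
          unfolding eq by (simp only: dvd_add_left_iff dvd_refl)
        then show ?thesis using 3 i by (auto simp: c'_def)
      next
        case 4
        then show ?thesis using Suc.prems(5)[of "i + 1"] i by (simp add: c'_def)
      qed
    qed (fact Suc.prems(3))
    moreover have "c' 0 = c 0"
      using j by (simp add: c'_def)
    \<comment> \<open>Deleting the last index also keeps the end value, because then
      \<open>c (Suc l) = c l\<close>.\<close>
    moreover have "c' l = c (Suc l)"
      using j Suc.prems(2) by (cases "j = Suc l") (auto simp: c'_def)
    \<comment> \<open>A deletion makes the bound strict by \<open>S\<close>, so the equality clause
      is vacuous in this case.\<close>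
    moreover have "int l * S < int (Suc l) * S"
      using Suc.prems(3) by (simp add: algebra_simps)
    ultimately show ?thesis
      by linarith
  next
    case False
    have step: "c i - c (i + 1) \<le> c (i - 1) - c i" if i: "0 < i" "i \<le> Suc l" for i
    proof -
      obtain q where q: "c (i - 1) + c (i + 1) = c i * q"
        using Suc.prems(5)[OF i] by (auto elim: dvdE)
      have pos: "c i > 0" "c (i - 1) > 0" "c (i + 1) \<ge> 0"
        using Suc.prems(1)[of i] Suc.prems(1)[of "i - 1"] i
          Suc.prems(1)[of "i + 1"] Suc.prems(2) by (simp, simp, cases "i = Suc l", simp_all)
      then have "q > 0"
        using q zero_less_mult_pos[of "c i" q] by simp
      \<comment> \<open>A quotient of 1 would make the vertex deletable; hence \<open>q\<close> is
        at least 2 and the chain is convex at \<open>i\<close>.\<close>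
      moreover have "q \<noteq> 1"
        using False i q by auto
      ultimately have "c i * 2 \<le> c i * q"
        using pos by (intro mult_left_mono) auto
      then show ?thesis using q by simp
    qed
    have diff: "c i - c (i + 1) \<le> S" if "i \<le> l" for i
      using that
    proof (induction i)
      case 0
      have "c 1 > 0" using Suc.prems(1)[of 1] by simp
      then show ?case using zdvd_imp_le[OF Suc.prems(4)] Suc.prems(3) by simp
    next
      case (Suc i)
      then show ?case using step[of "i + 1"] by simp
    qed
    have upper: "c i \<le> c (Suc l) + int (Suc l - i) * S" if "i \<le> Suc l" for i
      using that
    proof (induction i rule: inc_induct)
      case (step i)
      have "int (Suc l - i) * S = int (Suc l - Suc i) * S + S"
        using step.hyps by (simp add: Suc_diff_le algebra_simps)
      then show ?case using step.IH diff[of i] step.hyps by simp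
    qed simp
    have lower: "c 0 \<le> c i + int i * S" if "i \<le> Suc l" for i
      using that
    proof (induction i)
      case (Suc i)
      then show ?case using diff[of i] by (simp add: algebra_simps)
    qed simp
    \<comment> \<open>\<open>upper\<close> telescopes from the end and \<open>lower\<close> from the
      start; if \<open>c 0\<close> attains the total bound, the two squeeze every
      \<open>c i\<close>.\<close>
    have "c i = c (Suc l) + int (Suc l - i) * S"
      if "c 0 = c (Suc l) + int (Suc l) * S" "i \<le> Suc l" for i
    proof -
      have "int (Suc l) * S = int i * S + int (Suc l - i) * S"
        using that(2) by (simp add: of_nat_diff algebra_simps)
      then show ?thesis using upper[of i] lower[of i] that by linarith
    qed
    moreover have "c 0 \<le> c (Suc l) + int (Suc l) * S"
      using upper[of 0] by (simp del: of_nat_Suc)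
    ultimately show ?thesis by blast
  qed
qed

section \<open>The order of the critical group\<close>

lemma cokernel_rcos_eq_iff:
  fixes V :: "'a set" and M :: "'a \<Rightarrow> 'a \<Rightarrow> int"
  defines "I \<equiv> mat_vec V M ` carrier (integer_vectors V)"
  assumes "z \<in> carrier (integer_vectors V)" and "z' \<in> carrier (integer_vectors V)"
  shows "I #>\<^bsub>integer_vectors V\<^esub> z = I #>\<^bsub>integer_vectors V\<^esub> z' \<longleftrightarrow> (\<lambda>v\<in>V. z v - z' v) \<in> I"
proof -
  let ?Z = "integer_vectors V"
  interpret comm_group ?Z by (rule comm_group_integer_vectors)
  interpret N: normal I ?Z unfolding I_def by (rule normal_image_mat_vec)
  have "z \<otimes>\<^bsub>?Z\<^esub> inv\<^bsub>?Z\<^esub> z' = (\<lambda>v\<in>V. z v - z' v)"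
    by (subst inv_integer_vectors[OF assms(3)]) (auto simp: fun_eq_iff)
  moreover have "I #>\<^bsub>?Z\<^esub> z = I #>\<^bsub>?Z\<^esub> z' \<longleftrightarrow> z \<in> I #>\<^bsub>?Z\<^esub> z'"
    using assms(2,3) N.subgroup_axioms by (metis rcos_self repr_independence)
  moreover have "z \<in> I #>\<^bsub>?Z\<^esub> z' \<longleftrightarrow> z \<otimes>\<^bsub>?Z\<^esub> inv\<^bsub>?Z\<^esub> z' \<in> I"
    using N.rcos_module[OF is_group assms(3,2)] .
  ultimately show ?thesis by simp
qed

lemma rcos_in_torsion_part_cokernel_iff:
  fixes V :: "'a set" and M :: "'a \<Rightarrow> 'a \<Rightarrow> int"
  defines "I \<equiv> mat_vec V M ` carrier (integer_vectors V)"
  assumes "z \<in> carrier (integer_vectors V)"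
  shows "I #>\<^bsub>integer_vectors V\<^esub> z \<in> carrier (torsion_part (cokernel V M)) \<longleftrightarrow>
    (\<exists>m::nat. m > 0 \<and> (\<lambda>v\<in>V. int m * z v) \<in> I)"
proof -
  let ?Z = "integer_vectors V"
  interpret comm_group ?Z by (rule comm_group_integer_vectors)
  interpret N: normal I ?Z unfolding I_def by (rule normal_image_mat_vec)
  have "(I #>\<^bsub>?Z\<^esub> z) [^]\<^bsub>cokernel V M\<^esub> m = \<one>\<^bsub>cokernel V M\<^esub> \<longleftrightarrow> (\<lambda>v\<in>V. int m * z v) \<in> I"
    for m :: nat
  proof -
    have "(I #>\<^bsub>?Z\<^esub> z) [^]\<^bsub>cokernel V M\<^esub> m = I #>\<^bsub>?Z\<^esub> (z [^]\<^bsub>?Z\<^esub> m)"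
      using N.FactGroup_pow assms(2) unfolding cokernel_def I_def by blast
    moreover have "\<one>\<^bsub>cokernel V M\<^esub> = I"
      by (simp add: cokernel_def FactGroup_def I_def)
    moreover have "I #>\<^bsub>?Z\<^esub> (z [^]\<^bsub>?Z\<^esub> m) = I \<longleftrightarrow> z [^]\<^bsub>?Z\<^esub> m \<in> I"
      using assms(2) N.subgroup_axioms by (metis coset_join2 nat_pow_closed rcos_self)
    ultimately show ?thesis
      by (simp add: nat_pow_integer_vectors[OF assms(2)])
  qed
  moreover have "I #>\<^bsub>?Z\<^esub> z \<in> carrier (cokernel V M)"
    using assms(2) unfolding cokernel_def FactGroup_def RCOSETS_def I_def by auto
  ultimately show ?thesis
    by (auto simp: torsion_part_def)
qed

lemma torsion_part_cokernel_rcosE: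
  assumes "C \<in> carrier (torsion_part (cokernel V M))"
  obtains z where "z \<in> carrier (integer_vectors V)"
    and "C = (mat_vec V M ` carrier (integer_vectors V)) #>\<^bsub>integer_vectors V\<^esub> z"
  using assms by (auto simp: torsion_part_def cokernel_def FactGroup_def RCOSETS_def)

text \<open>Serves to solve the Laplacian equations along the path one vertex after the
  other.\<close>

lemma second_order_recurrence_exists:
  fixes e f :: "nat \<Rightarrow> int"
  obtains u where "u 0 = a" "u 1 = b" "\<And>i. i > 0 \<Longrightarrow> u (i + 1) = e i * u i - u (i - 1) - f i"
proof -
  \<comment> \<open>The recursion carries the pair of two consecutive values.\<close>
  define p where "p = rec_nat (a, b) (\<lambda>i (s, t). (t, e (Suc i) * t - s - f (Suc i)))"
  define u where "u i = fst (p i)" for i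
  have snd_p: "snd (p i) = u (Suc i)" for i
    by (simp add: u_def p_def split_beta)
  have "u (i + 1) = e i * u i - u (i - 1) - f i" if "i > 0" for i
  proof -
    obtain j where j: "i = Suc j" using \<open>i > 0\<close> by (cases i) auto
    have "snd (p (Suc j)) = e (Suc j) * snd (p j) - fst (p j) - f (Suc j)"
      by (simp add: p_def split_beta)
    then show ?thesis by (simp add: j snd_p) (simp add: u_def)
  qed
  moreover have "u 0 = a" "u 1 = b"
    by (simp_all add: u_def p_def)
  ultimately show thesis using that by blast
qed

section \<open>Divisibility relations within an arithmetical structure\<close>

locale bident_structure =
  fixes n :: nat and d r :: "bident_vertex \<Rightarrow> int"
  assumes n_ge: "n \<ge> 4" and arith: "(d, r) \<in> arithmetical_structures (bident n)"
begin

definition l :: nat where "l = n - 3"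

text \<open>The value 0 past the end gives the last vertex the same recurrence as the inner
  vertices.\<close>

definition c :: "nat \<Rightarrow> int" where "c i = (if i \<le> l then r (V_path i) else 0)"

abbreviation V :: "bident_vertex set" where "V \<equiv> vertices (bident n)"

abbreviation L :: "bident_vertex \<Rightarrow> bident_vertex \<Rightarrow> int" where
  "L \<equiv> generalized_laplacian (bident n) d"

abbreviation I :: "(bident_vertex \<Rightarrow> int) set" where
  "I \<equiv> mat_vec V L ` carrier (integer_vectors V)"

text \<open>The division is exact, see \<open>K_eq\<close>.\<close>

definition K :: int where "K = c 0 div (r V_x * r V_y * c l)"

lemma l_pos: "l > 0"
  using n_ge by (simp add: l_def)

lemma V_eq: "V = insert V_x (insert V_y (V_path ` {..l}))"
  by (simp add: vertices_bident l_def atLeast0AtMost)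

lemma in_V [simp]: "V_x \<in> V" "V_y \<in> V" "V_path i \<in> V \<longleftrightarrow> i \<le> l"
  by (auto simp: V_eq)

lemma r_pos: "v \<in> V \<Longrightarrow> r v > 0"
  using arith by (auto simp: arithmetical_structures_def)

lemma c_pos: "i \<le> l \<Longrightarrow> c i > 0"
  using r_pos[of "V_path i"] by (simp add: c_def)

lemma laplacian_r: "v \<in> V \<Longrightarrow> mat_vec V L r v = 0"
  using arith by (auto simp: arithmetical_structures_def fun_eq_iff)

lemma leaf_eq: "d V_x * r V_x = c 0" "d V_y * r V_y = c 0"
  using laplacian_r[of V_x] laplacian_r[of V_y] by (simp_all add: bident_laplacian_leaves c_def)

lemma center_eq: "d (V_path 0) * c 0 = r V_x + r V_y + c 1"
  using laplacian_r[of "V_path 0"] bident_laplacian_center[OF n_ge, of d r] l_pos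
  by (simp add: c_def)

lemma path_eq: "0 < i \<Longrightarrow> i \<le> l \<Longrightarrow> d (V_path i) * c i = c (i - 1) + c (i + 1)"
  using laplacian_r[of "V_path i"] bident_laplacian_path[of i n d r]
  by (auto simp: c_def l_def split: if_splits)

text \<open>The recurrence passes divisibility from two consecutive values to the next; past the end
  all values are 0.\<close>

lemma dvd_path:
  assumes "h dvd c 0" "h dvd c 1"
  shows "h dvd c i"
proof -
  have "h dvd c i \<and> h dvd c (i + 1)"
  proof (induction i)
    case (Suc i)
    show ?case
    proof (cases "i + 1 \<le> l")
      case True
      then have "c (Suc i + 1) = d (V_path (i + 1)) * c (i + 1) - c i"
        using path_eq[of "i + 1"] by simp
      then show ?thesis using Suc by simp
    qed (use Suc in \<open>simp add: c_def\<close>)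
  qed (use assms in simp)
  then show ?thesis ..
qed

text \<open>The recurrence runs backwards from \<open>c l\<close> and
  \<open>c (l + 1) = 0\<close>.\<close>

lemma end_dvd_path: "c l dvd c i"
proof (cases "i \<le> l")
  case True
  then have "c l dvd c i \<and> c l dvd c (i + 1)"
  proof (induction i rule: inc_induct)
    case base
    then show ?case by (simp add: c_def)
  next
    case (step i)
    have "c i = d (V_path (i + 1)) * c (i + 1) - c (i + 2)"
      using path_eq[of "i + 1"] step.hyps by simp
    then show ?case using step.IH by simp
  qed
  then show ?thesis ..
qed (simp add: c_def)

lemma end_dvd_leaf_sum: "c l dvd r V_x + r V_y"
proof -
  have "r V_x + r V_y = d (V_path 0) * c 0 - c 1" using center_eq by simp
  then show ?thesis by (simp add: end_dvd_path)
qed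

text \<open>Such an \<open>h\<close> divides \<open>c 0\<close> by a leaf equation and
  \<open>c 1\<close> by the center equation, hence every entry of \<open>r\<close>, and these have
  gcd 1.\<close>

lemma common_divisor_leaves_unit:
  assumes "h dvd r V_x" "h dvd r V_y"
  shows "is_unit h"
proof -
  have "h dvd c 0" using assms(1) leaf_eq(1) by (metis dvd_mult)
  moreover have "c 1 = d (V_path 0) * c 0 - (r V_x + r V_y)" using center_eq by simp
  ultimately have "h dvd c 1" using assms by simp
  then have "h dvd c i" for i using \<open>h dvd c 0\<close> dvd_path by blast
  then have "h dvd r v" if "v \<in> V" for v
    using that assms by (auto simp: V_eq) (metis c_def)
  then have "h dvd Gcd (r ` V)" by (auto intro: Gcd_greatest)
  then show ?thesis using arith by (auto simp: arithmetical_structures_def)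
qed

lemma coprime_leaves: "coprime (r V_x) (r V_y)"
  by (rule coprimeI) (rule common_divisor_leaves_unit)

text \<open>As \<open>c l\<close> divides the sum of the leaf values, a common divisor of
  \<open>c l\<close> and one leaf value divides the other one too.\<close>

lemma coprime_leaf_end: "coprime (r V_x) (c l)" "coprime (r V_y) (c l)"
proof -
  show "coprime (r V_x) (c l)"
  proof (rule coprimeI)
    fix h assume "h dvd r V_x" "h dvd c l"
    then show "is_unit h"
      using common_divisor_leaves_unit end_dvd_leaf_sum by (meson dvd_add_right_iff dvd_trans)
  qed
  show "coprime (r V_y) (c l)"
  proof (rule coprimeI)
    fix h assume "h dvd r V_y" "h dvd c l"
    then show "is_unit h"
      using common_divisor_leaves_unit end_dvd_leaf_sum by (meson dvd_add_left_iff dvd_trans)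
  qed
qed

lemma K_eq: "c 0 = K * (r V_x * r V_y * c l)"
proof -
  have "r V_x dvd c 0" "r V_y dvd c 0"
    using leaf_eq by (metis dvd_triv_right)+
  then have "r V_x * r V_y dvd c 0"
    using coprime_leaves divides_mult by blast
  moreover have "coprime (r V_x * r V_y) (c l)"
    using coprime_leaf_end by simp
  ultimately have "r V_x * r V_y * c l dvd c 0"
    using end_dvd_path divides_mult by blast
  then show ?thesis by (simp add: K_def)
qed

lemma leaf_d_eq: "d V_x = K * c l * r V_y" "d V_y = K * c l * r V_x"
proof -
  have "d V_x * r V_x = (K * c l * r V_y) * r V_x" "d V_y * r V_y = (K * c l * r V_x) * r V_y"
    using leaf_eq K_eq by (simp_all add: mult_ac)
  then show "d V_x = K * c l * r V_y" "d V_y = K * c l * r V_x"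
    using r_pos[of V_x] r_pos[of V_y] by simp_all
qed

lemma K_pos: "K > 0"
proof -
  have "r V_x * r V_y * c l > 0"
    using r_pos[of V_x] r_pos[of V_y] c_pos[of l] by simp
  then show ?thesis
    using K_eq c_pos[of 0] zero_less_mult_pos2 by simp
qed

section \<open>Image of the Laplacian inside the orthogonal complement of \<open>r\<close>\<close>

lemma L_sym: "L u v = L v u"
  by (simp add: generalized_laplacian_def diag_matrix_def adjacency_matrix_def insert_commute)

lemma dot_laplacian: "(\<Sum>v\<in>V. r v * mat_vec V L w v) = 0"
proof -
  have "(\<Sum>v\<in>V. r v * mat_vec V L w v) = (\<Sum>v\<in>V. w v * mat_vec V L r v)"
    by (rule sum_mult_mat_vec_symmetric[OF finite_vertices_bident L_sym])
  then show ?thesis using laplacian_r by simp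
qed

lemma sum_V: "(\<Sum>v\<in>V. f v) = f V_x + f V_y + (\<Sum>i\<le>l. f (V_path i))"
  by (simp only: sum_vertices_bident l_def)

text \<open>Modulo \<open>c l\<close> all path values vanish and \<open>r V_y\<close> is
  \<open>- r V_x\<close>, so orthogonality reads \<open>r V_x * (z V_x - z V_y) = 0\<close>, where
  \<open>r V_x\<close> is invertible.\<close>

lemma end_dvd_leaf_diff:
  assumes "(\<Sum>v\<in>V. r v * z v) = 0"
  shows "c l dvd z V_x - z V_y"
proof -
  have "c l dvd (\<Sum>i\<le>l. r (V_path i) * z (V_path i))"
    using end_dvd_path by (intro dvd_sum) (metis atMost_iff c_def dvd_mult2)
  moreover have "r V_x * (z V_x - z V_y) =
    - (r V_x + r V_y) * z V_y - (\<Sum>i\<le>l. r (V_path i) * z (V_path i))"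
    using assms by (simp add: sum_V algebra_simps)
  ultimately have "c l dvd r V_x * (z V_x - z V_y)"
    using end_dvd_leaf_sum by (metis dvd_diff dvd_minus_iff dvd_mult2)
  then show ?thesis
    using coprime_leaf_end(1) by (simp add: coprime_dvd_mult_right_iff coprime_commute)
qed

text \<open>The leaf difference of \<open>L w\<close> is
  \<open>K * c l * (r V_y * w V_x - r V_x * w V_y)\<close>, and by Bezout the bracket takes every
  integer value. Once the leaf values of a preimage are chosen, the equations dictate its remaining
  entries.\<close>

lemma image_iff_dvd:
  assumes z: "z \<in> carrier (integer_vectors V)" and dot: "(\<Sum>v\<in>V. r v * z v) = 0"
  shows "z \<in> I \<longleftrightarrow> K * c l dvd z V_x - z V_y"
proof
  assume "z \<in> I"
  then obtain w where w: "z = mat_vec V L w" by blast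
  have "z V_x - z V_y = K * c l * (r V_y * w V_x - r V_x * w V_y)"
    unfolding w by (simp add: bident_laplacian_leaves leaf_d_eq algebra_simps)
  then show "K * c l dvd z V_x - z V_y" by simp
next
  assume "K * c l dvd z V_x - z V_y"
  then obtain m where m: "z V_x - z V_y = K * c l * m" by (elim dvdE)
  obtain a b where ab: "a * r V_x + b * r V_y = 1"
    using coprime_leaves by (metis bezout_int coprime_iff_gcd_eq_1)
  have "r V_y * (b * m) - r V_x * (- a * m) = (a * r V_x + b * r V_y) * m"
    by (simp add: algebra_simps)
  then have bez: "r V_y * (b * m) - r V_x * (- a * m) = m"
    unfolding ab by simp
  \<comment> \<open>The equation at \<open>V_x\<close> forces this value at \<open>V_path 0\<close>;
    \<open>w0'\<close> shows that the equation at \<open>V_y\<close> forces the same one.\<close>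
  define w0 where "w0 = d V_x * (b * m) - z V_x"
  have w0': "w0 = d V_y * (- a * m) - z V_y"
  proof -
    have "d V_x * (b * m) - d V_y * (- a * m) = K * c l * (r V_y * (b * m) - r V_x * (- a * m))"
      by (simp add: leaf_d_eq algebra_simps)
    then show ?thesis using m unfolding bez w0_def by simp
  qed
  obtain u where u: "u 0 = w0" "u 1 = d (V_path 0) * w0 - b * m - (- a * m) - z (V_path 0)"
    "\<And>i. i > 0 \<Longrightarrow> u (i + 1) = d (V_path i) * u i - u (i - 1) - z (V_path i)"
    using second_order_recurrence_exists[of w0 "d (V_path 0) * w0 - b * m - (- a * m) - z (V_path 0)"
      "\<lambda>i. d (V_path i)" "\<lambda>i. z (V_path i)"] by blast
  define w where "w = (\<lambda>v\<in>V. case v of V_x \<Rightarrow> b * m | V_y \<Rightarrow> - a * m | V_path i \<Rightarrow> u i)"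
  have w [simp]: "w V_x = b * m" "w V_y = - a * m" "i \<le> l \<Longrightarrow> w (V_path i) = u i" for i
    by (simp_all add: w_def)
  have leaves: "mat_vec V L w V_x = z V_x" "mat_vec V L w V_y = z V_y"
    using w0' by (simp_all add: bident_laplacian_leaves u(1)) (simp add: w0_def)
  have path: "mat_vec V L w (V_path i) = z (V_path i)" if "i < l" for i
  proof (cases "i = 0")
    case True
    then show ?thesis
      using bident_laplacian_center[OF n_ge, of d w] u l_pos by simp
  next
    case False
    then show ?thesis
      using bident_laplacian_path[of i n d w] u(3)[of i] that by (simp flip: l_def)
  qed
  \<comment> \<open>The equation at the last vertex holds because both sides are orthogonal to \<open>r\<close>.\<close>
  have "0 = (\<Sum>v\<in>V. r v * mat_vec V L w v) - (\<Sum>v\<in>V. r v * z v)"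
    using dot dot_laplacian by simp
  also have "\<dots> = r (V_path l) * (mat_vec V L w (V_path l) - z (V_path l))"
    using path by (simp add: sum_V leaves flip: lessThan_Suc_atMost) (simp add: algebra_simps)
  finally have "mat_vec V L w (V_path l) = z (V_path l)"
    using r_pos[of "V_path l"] by simp
  then have eq: "mat_vec V L w v = z v" if "v \<in> V" for v
    using that leaves path by (auto simp: V_eq order.order_iff_strict)
  have "mat_vec V L w = z"
  proof
    fix v
    show "mat_vec V L w v = z v"
    proof (cases "v \<in> V")
      case False
      then have "z v = undefined" using z by (auto simp: PiE_def extensional_def)
      then show ?thesis using False by (simp add: mat_vec_def)
    qed (rule eq)
  qed
  moreover have "w \<in> carrier (integer_vectors V)"
    by (simp add: w_def)
  ultimately show "z \<in> I" by blast
qed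

text \<open>The image is orthogonal to \<open>r\<close>, and so is any vector with a positive
  multiple in it. Conversely the multiple by \<open>K\<close> always suffices, as the leaf
  difference is already divisible by \<open>c l\<close>.\<close>

lemma torsion_iff_dot:
  assumes "z \<in> carrier (integer_vectors V)"
  shows "I #>\<^bsub>integer_vectors V\<^esub> z \<in> carrier (critical_group (bident n) (d, r)) \<longleftrightarrow>
    (\<Sum>v\<in>V. r v * z v) = 0"
proof -
  have dot: "(\<Sum>v\<in>V. r v * (\<lambda>v\<in>V. int m * z v) v) = int m * (\<Sum>v\<in>V. r v * z v)" for m
    by (simp add: sum_distrib_left mult_ac)
  have "(\<exists>m::nat. m > 0 \<and> (\<lambda>v\<in>V. int m * z v) \<in> I) \<longleftrightarrow> (\<Sum>v\<in>V. r v * z v) = 0"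
  proof
    assume "\<exists>m::nat. m > 0 \<and> (\<lambda>v\<in>V. int m * z v) \<in> I"
    then obtain m :: nat and w where m: "m > 0" "(\<lambda>v\<in>V. int m * z v) = mat_vec V L w"
      by blast
    have "int m * (\<Sum>v\<in>V. r v * z v) = 0"
      unfolding dot[symmetric] m(2) by (rule dot_laplacian)
    then show "(\<Sum>v\<in>V. r v * z v) = 0" using m(1) by simp
  next
    assume 0: "(\<Sum>v\<in>V. r v * z v) = 0"
    have "K * c l dvd K * (z V_x - z V_y)"
      using end_dvd_leaf_diff[OF 0] by (simp add: mult_dvd_mono)
    then have "(\<lambda>v\<in>V. int (nat K) * z v) \<in> I"
      using 0 K_pos dot[of "nat K"] by (subst image_iff_dvd) (simp_all add: right_diff_distrib)
    then show "\<exists>m::nat. m > 0 \<and> (\<lambda>v\<in>V. int m * z v) \<in> I"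
      using K_pos by (intro exI[of _ "nat K"]) simp
  qed
  then show ?thesis
    using rcos_in_torsion_part_cokernel_iff[OF assms, of L] by (simp add: critical_group_def)
qed

text \<open>In the orthogonal complement of \<open>r\<close>, a coset of the image is determined by
  the leaf difference modulo \<open>K * c l\<close>. This difference is a multiple of
  \<open>c l\<close>, which leaves \<open>K\<close> classes.\<close>

lemma order_critical_group: "order (critical_group (bident n) (d, r)) = nat K"
proof -
  let ?Z = "integer_vectors V"
  let ?C = "carrier (critical_group (bident n) (d, r))"
  \<comment> \<open>Representatives with leaf difference \<open>c l * t\<close>; the entry at the
    end of the path restores orthogonality to \<open>r\<close>.\<close>
  define z where "z t = (\<lambda>v\<in>V. if v = V_x then c l * t
    else if v = V_path l then - r V_x * t else 0)" for t
  have z: "z t \<in> carrier ?Z" for t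
    by (simp add: z_def)
  have dot: "(\<Sum>v\<in>V. r v * z t v) = 0" for t
    by (simp add: sum_V z_def) (simp add: c_def flip: lessThan_Suc_atMost)
  have diff: "z t V_x - z t V_y = c l * t" for t
    by (simp add: z_def)
  have eq_iff: "I #>\<^bsub>?Z\<^esub> w = I #>\<^bsub>?Z\<^esub> z t \<longleftrightarrow> K * c l dvd w V_x - w V_y - c l * t"
    if w: "w \<in> carrier ?Z" "(\<Sum>v\<in>V. r v * w v) = 0" for w t
  proof -
    have "(\<Sum>v\<in>V. r v * (\<lambda>v\<in>V. w v - z t v) v) = (\<Sum>v\<in>V. r v * w v) - (\<Sum>v\<in>V. r v * z t v)"
      by (simp add: right_diff_distrib sum_subtractf)
    then have "(\<Sum>v\<in>V. r v * (\<lambda>v\<in>V. w v - z t v) v) = 0"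
      using dot[of t] w(2) by simp
    then have "(\<lambda>v\<in>V. w v - z t v) \<in> I \<longleftrightarrow> K * c l dvd w V_x - z t V_x - (w V_y - z t V_y)"
      by (subst image_iff_dvd) simp_all
    moreover have "w V_x - z t V_x - (w V_y - z t V_y) = w V_x - w V_y - c l * t"
      using diff[of t] by simp
    ultimately show ?thesis
      using cokernel_rcos_eq_iff[OF w(1) z[of t], of L] by simp
  qed
  have "bij_betw (\<lambda>t. I #>\<^bsub>?Z\<^esub> z t) {0..<K} ?C"
  proof (rule bij_betw_imageI)
    show "inj_on (\<lambda>t. I #>\<^bsub>?Z\<^esub> z t) {0..<K}"
    proof (rule inj_onI)
      fix s t assume st: "s \<in> {0..<K}" "t \<in> {0..<K}" "I #>\<^bsub>?Z\<^esub> z s = I #>\<^bsub>?Z\<^esub> z t"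
      then have "K * c l dvd (s - t) * c l"
        using eq_iff[OF z dot, of s t] by (simp add: diff algebra_simps)
      then have "K dvd s - t"
        using c_pos[of l] by (subst (asm) dvd_times_right_cancel_iff) auto
      then have "s mod K = t mod K" by (simp add: mod_eq_dvd_iff)
      then show "s = t" using st by simp
    qed
    show "(\<lambda>t. I #>\<^bsub>?Z\<^esub> z t) ` {0..<K} = ?C"
    proof (intro equalityI subsetI)
      fix C assume "C \<in> (\<lambda>t. I #>\<^bsub>?Z\<^esub> z t) ` {0..<K}"
      then show "C \<in> ?C" using torsion_iff_dot[OF z] dot by auto
    next
      fix C assume C: "C \<in> ?C"
      then obtain w where w: "w \<in> carrier ?Z" "C = I #>\<^bsub>?Z\<^esub> w"
        unfolding critical_group_def fst_conv by (rule torsion_part_cokernel_rcosE)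
      then have w0: "(\<Sum>v\<in>V. r v * w v) = 0" using C torsion_iff_dot by blast
      then obtain t where t: "w V_x - w V_y = c l * t"
        using end_dvd_leaf_diff by (metis dvdE)
      have "w V_x - w V_y - c l * (t mod K) = K * c l * (t div K)"
        unfolding t right_diff_distrib[symmetric] minus_mod_eq_mult_div by (simp add: mult_ac)
      then have "C = I #>\<^bsub>?Z\<^esub> z (t mod K)"
        using eq_iff[OF w(1) w0] w(2) by simp
      then show "C \<in> (\<lambda>t. I #>\<^bsub>?Z\<^esub> z t) ` {0..<K}"
        using K_pos by auto
    qed
  qed
  then have "card ?C = card {0..<K}" by (metis bij_betw_same_card)
  then show ?thesis by (simp add: order_def)
qed

end

section \<open>Bounds on the order\<close>

context bident_structure
begin

lemma path_bound:
  shows "c 0 \<le> c l + int l * (r V_x + r V_y)"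
    and "c 0 = c l + int l * (r V_x + r V_y) \<Longrightarrow> i \<le> l \<Longrightarrow>
      c i = c l + int (l - i) * (r V_x + r V_y)"
proof -
  have "c 0 \<le> c l + int l * (r V_x + r V_y) \<and> (c 0 = c l + int l * (r V_x + r V_y) \<longrightarrow>
    (\<forall>i\<le>l. c i = c l + int (l - i) * (r V_x + r V_y)))"
  proof (rule chain_bound)
    show "r V_x + r V_y > 0"
      using r_pos[of V_x] r_pos[of V_y] by simp
    show "c 0 dvd c 1 + (r V_x + r V_y)"
      using center_eq by (metis add.commute dvd_triv_right)
    show "c i dvd c (i - 1) + c (i + 1)" if "0 < i" "i \<le> l" for i
      using path_eq[OF that] by (metis dvd_triv_right)
  qed (auto simp: c_pos, simp add: c_def)
  then show "c 0 \<le> c l + int l * (r V_x + r V_y)"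
    and "c 0 = c l + int l * (r V_x + r V_y) \<Longrightarrow> i \<le> l \<Longrightarrow>
      c i = c l + int (l - i) * (r V_x + r V_y)"
    by blast+
qed

lemma K_bound: "K * (r V_x * r V_y * c l) \<le> c l + int l * (r V_x + r V_y)"
  using path_bound(1) K_eq by simp

text \<open>For positive integers, \<open>g \<le> x * y * g\<close> and
  \<open>x + y \<le> 2 * (x * y * g)\<close>, so \<open>x * y * g\<close> cancels from the path
  bound. The extremal \<open>K\<close> makes both estimates tight: \<open>x * y = 1\<close> and
  \<open>x + y = 2 * g\<close>.\<close>

lemma K_le: "K \<le> 2 * int l + 1"
  and K_maximal: "K = 2 * int l + 1 \<Longrightarrow> r V_x = 1 \<and> r V_y = 1 \<and> c l = 1"
proof -
  define x y g where "x = r V_x" and "y = r V_y" and "g = c l"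
  have pos: "x \<ge> 1" "y \<ge> 1" "g \<ge> 1"
    using r_pos[of V_x] r_pos[of V_y] c_pos[of l] by (simp_all add: x_def y_def g_def)
  have xy: "1 \<le> x * y" "x \<le> x * y" "y \<le> x * y"
    using pos mult_mono[of 1 x 1 y] by (simp_all add: mult_le_cancel_left1 mult_le_cancel_right1)
  have g_le: "g \<le> x * y * g" and xy_le: "x * y \<le> x * y * g"
    using pos xy(1) by (simp_all add: mult_le_cancel_left1 mult_le_cancel_right1)
  have lin: "int l * (x + y) \<le> int l * (2 * (x * y * g))"
    using xy xy_le by (intro mult_left_mono) auto
  have bound: "K * (x * y * g) \<le> g + int l * (x + y)"
    using K_bound by (simp add: x_def y_def g_def)
  also have "\<dots> \<le> (2 * int l + 1) * (x * y * g)"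
    using g_le lin by (simp add: algebra_simps)
  finally show "K \<le> 2 * int l + 1"
    using g_le pos by (auto simp: mult_le_cancel_right)
  assume K: "K = 2 * int l + 1"
  have "x * y * g + int l * (2 * (x * y * g)) \<le> g + int l * (x + y)"
    using bound unfolding K by (simp add: algebra_simps)
  then have "x * y * g = g" "int l * (x + y) = int l * (2 * (x * y * g))"
    using g_le lin by linarith+
  then have "x * y = 1" "x + y = 2 * g"
    using pos l_pos by auto
  then show "r V_x = 1 \<and> r V_y = 1 \<and> c l = 1"
    using pos xy by (simp add: x_def y_def g_def)
qed

text \<open>The first alternative comes from \<open>x = y = 1\<close>, where 2 divides
  \<open>g\<close>, and also covers leaf values 1 and 2 with \<open>g \<ge> 2\<close>. The second is
  leaf values 1 and 2 with \<open>g = 1\<close>, where 3 dividing \<open>K\<close> would force 3 to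
  divide \<open>g\<close>. The third covers all other leaf values.\<close>

lemma even_K_bound:
  assumes "even K"
  shows "K \<le> 1 + int l \<or> 2 * K \<le> 1 + 3 * int l \<and> \<not> 3 dvd K \<or> 3 * K \<le> 1 + 4 * int l"
proof -
  define x y g where "x = r V_x" and "y = r V_y" and "g = c l"
  have pos: "x \<ge> 1" "y \<ge> 1" "g \<ge> 1"
    using r_pos[of V_x] r_pos[of V_y] c_pos[of l] by (simp_all add: x_def y_def g_def)
  have bound: "K * (x * y * g) \<le> g + int l * (x + y)"
    using K_bound by (simp add: x_def y_def g_def)
  have "g * (K * (x * y)) \<le> g + int l * (x + y)"
    using bound by (simp add: mult_ac)
  \<comment> \<open>Enlarging the second summand by the factor \<open>g \<ge> 1\<close> lets
    \<open>g\<close> be cancelled.\<close>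
  also have "\<dots> \<le> g * (1 + int l * (x + y))"
    using pos mult_right_mono[of 1 g "int l * (x + y)"] by (simp add: distrib_left)
  finally have bound': "K * (x * y) \<le> 1 + int l * (x + y)"
    using pos by simp
  have dvd_end: "h dvd g" if "h dvd c 0" "h dvd x + y" for h
  proof -
    have "c 1 = d (V_path 0) * c 0 - (x + y)"
      using center_eq by (simp add: x_def y_def)
    then show ?thesis
      using that dvd_path[of h l] by (simp add: g_def)
  qed
  have c0: "c 0 = K * (x * y * g)"
    using K_eq by (simp add: x_def y_def g_def)
  consider "x = 1 \<and> y = 1" | "x = 1 \<and> y = 2 \<or> x = 2 \<and> y = 1" | "3 * (x + y) \<le> 4 * (x * y) \<and> 3 \<le> x * y"
  proof -
    have "3 * (x + y) \<le> 4 * (x * y) \<and> 3 \<le> x * y"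
      if "x \<ge> 3 \<or> y \<ge> 3 \<or> x = 2 \<and> y = 2"
    proof -
      \<comment> \<open>Both estimates are tight at leaf values 1 and 3; the products linearize
        \<open>x * y\<close> there, the first for \<open>y \<ge> 3\<close>, the second for
        \<open>x \<ge> 3\<close>.\<close>
      have "0 \<le> (x - 1) * (y - 3) \<or> y = 1 \<or> y = 2" "0 \<le> (x - 3) * (y - 1) \<or> x = 1 \<or> x = 2"
        using pos by auto
      then show ?thesis using that pos by (auto simp: algebra_simps)
    qed
    then show ?thesis using that pos by linarith
  qed
  then show ?thesis
  proof cases
    case 1
    have "2 dvd g"
      using 1 assms by (intro dvd_end) (auto simp: c0)
    then have "g \<ge> 2" using pos by (auto intro: zdvd_imp_le)
    have "g * K \<le> g + int l * 2" using bound 1 by (simp add: mult_ac)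
    also have "\<dots> \<le> g + int l * g" using \<open>g \<ge> 2\<close> by (intro add_left_mono mult_left_mono) auto
    also have "\<dots> = g * (1 + int l)" by (simp add: algebra_simps)
    finally show ?thesis using pos by simp
  next
    case 2
    then have xy: "x * y = 2" "x + y = 3" by auto
    show ?thesis
    proof (cases "g = 1")
      case True
      have "\<not> 3 dvd K"
        using dvd_end[of 3] True xy(2) by (auto simp: c0)
      then show ?thesis using bound' xy by simp
    next
      case False
      then have "g \<ge> 2" using pos by simp
      have "g * (2 * K) \<le> g + int l * 3" using bound xy by (simp add: mult_ac)
      also have "\<dots> \<le> g + int l * (2 * g)"
        using \<open>g \<ge> 2\<close> by (intro add_left_mono mult_left_mono) auto
      also have "\<dots> = g * (1 + 2 * int l)" by (simp add: algebra_simps)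
      finally show ?thesis using pos by simp
    qed
  next
    case 3
    have "x * y * (3 * K) \<le> 3 + int l * (3 * (x + y))"
      using bound' by (simp add: algebra_simps)
    also have "\<dots> \<le> x * y + int l * (4 * (x * y))"
      using 3 by (intro add_mono mult_left_mono) auto
    also have "\<dots> = x * y * (1 + 4 * int l)" by (simp add: algebra_simps)
    finally have "x * y * (3 * K) \<le> x * y * (1 + 4 * int l)" by simp
    moreover have "x * y > 0" using 3 by linarith
    ultimately show ?thesis using mult_le_cancel_left_pos by blast
  qed
qed

end

section \<open>Extremal structures\<close>

text \<open>An end value of 1 makes the gcd 1 and the divisibility at the last vertex automatic;
  \<open>d\<close> then consists of the exact quotients.\<close>

lemma bident_structureI:
  fixes p :: "nat \<Rightarrow> int" and x y :: int
  assumes n: "n \<ge> 4" and pos: "x > 0" "y > 0" "\<And>i. i \<le> n - 3 \<Longrightarrow> p i > 0"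
    and leaves: "x dvd p 0" "y dvd p 0" and center: "p 0 dvd x + y + p 1"
    and path: "\<And>i. 0 < i \<Longrightarrow> i < n - 3 \<Longrightarrow> p i dvd p (i - 1) + p (i + 1)"
    and last: "p (n - 3) = 1"
  obtains d r where "bident_structure n d r" and "r V_x = x" and "r V_y = y"
    and "\<And>i. i \<le> n - 3 \<Longrightarrow> r (V_path i) = p i"
proof -
  let ?V = "vertices (bident n)"
  define q where "q i = (if i \<le> n - 3 then p i else 0)" for i
  define r where "r = (\<lambda>v\<in>?V. case v of V_x \<Rightarrow> x | V_y \<Rightarrow> y | V_path i \<Rightarrow> p i)"
  define d where "d = (\<lambda>v\<in>?V. case v of V_x \<Rightarrow> p 0 div x | V_y \<Rightarrow> p 0 div y
    | V_path i \<Rightarrow> (if i = 0 then x + y + p 1 else q (i - 1) + q (i + 1)) div p i)"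
  have r: "r V_x = x" "r V_y = y" "i \<le> n - 3 \<Longrightarrow> r (V_path i) = p i" for i
    by (auto simp: r_def vertices_bident)
  have d_leaves: "d V_x * x = p 0" "d V_y * y = p 0"
    using leaves by (auto simp: d_def vertices_bident)
  have d_center: "d (V_path 0) * p 0 = x + y + p 1"
    using center by (auto simp: d_def vertices_bident)
  have d_path: "d (V_path i) * p i = q (i - 1) + q (i + 1)" if i: "0 < i" "i \<le> n - 3" for i
  proof -
    have "p i dvd q (i - 1) + q (i + 1)"
      using path[of i] last i by (cases "i = n - 3") (auto simp: q_def)
    then show ?thesis using i by (auto simp: d_def vertices_bident)
  qed
  have r_pos: "r v > 0" if "v \<in> ?V" for v
    using that pos by (auto simp: r_def vertices_bident)
  have d_pos: "d v > 0" if v: "v \<in> ?V" for v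
  proof (cases v)
    case V_x
    then show ?thesis using d_leaves(1) pos(1) pos(3)[of 0] zero_less_mult_pos2[of "d V_x" x] by simp
  next
    case V_y
    then show ?thesis using d_leaves(2) pos(2) pos(3)[of 0] zero_less_mult_pos2[of "d V_y" y] by simp
  next
    case (V_path i)
    then have i: "i \<le> n - 3" using v by (auto simp: vertices_bident)
    have "d (V_path i) * p i > 0"
    proof (cases "i = 0")
      case True
      then show ?thesis using d_center pos(1,2) pos(3)[of 1] n by (simp add: Suc_le_eq)
    next
      case False
      then have "q (i - 1) > 0" "q (i + 1) \<ge> 0"
        using i pos(3)[of "i - 1"] pos(3)[of "i + 1"] by (auto simp: q_def)
      then show ?thesis using d_path[of i] False i by simp
    qed
    then show ?thesis using V_path pos(3)[OF i] zero_less_mult_pos2 by blast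
  qed
  have kernel: "mat_vec ?V (generalized_laplacian (bident n) d) r v = 0" if v: "v \<in> ?V" for v
  proof (cases v)
    case V_x
    then show ?thesis using d_leaves by (simp add: bident_laplacian_leaves r)
  next
    case V_y
    then show ?thesis using d_leaves by (simp add: bident_laplacian_leaves r)
  next
    case (V_path i)
    then have i: "i \<le> n - 3" using v by (auto simp: vertices_bident)
    show ?thesis
    proof (cases "i = 0")
      case True
      then show ?thesis
        using V_path d_center n bident_laplacian_center[OF n, of d r] by (simp add: r)
    next
      case False
      then have "q (i - 1) = r (V_path (i - 1))"
        "q (i + 1) = (if i < n - 3 then r (V_path (i + 1)) else 0)"
        using i by (auto simp: r q_def)
      then show ?thesis
        using V_path d_path[of i] i False bident_laplacian_path[of i n d r] by (simp add: r(3)[OF i])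
    qed
  qed
  have "1 \<in> r ` ?V"
    using r(3)[of "n - 3"] last by (force simp: vertices_bident)
  then have "Gcd (r ` ?V) = 1"
    using Gcd_dvd[of 1 "r ` ?V"] by simp
  moreover have "mat_vec ?V (generalized_laplacian (bident n) d) r = (\<lambda>v\<in>?V. 0)"
  proof
    fix v
    show "mat_vec ?V (generalized_laplacian (bident n) d) r v = (\<lambda>v\<in>?V. 0) v"
      using kernel[of v] by (cases "v \<in> ?V") (simp_all add: mat_vec_def)
  qed
  moreover have "d \<in> ?V \<rightarrow>\<^sub>E {0<..}" "r \<in> ?V \<rightarrow>\<^sub>E {0<..}"
    using d_pos r_pos by (auto simp: PiE_def Pi_def) (simp_all add: d_def r_def)
  ultimately have "(d, r) \<in> arithmetical_structures (bident n)"
    by (simp add: arithmetical_structures_def)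
  then have "bident_structure n d r"
    using n by (simp add: bident_structure_def)
  then show ?thesis using r that by blast
qed

lemma bident_order_exists:
  fixes p :: "nat \<Rightarrow> int" and x y :: int
  assumes "n \<ge> 4" and "x > 0" "y > 0" "\<And>i. i \<le> n - 3 \<Longrightarrow> p i > 0"
    and "x dvd p 0" "y dvd p 0" and "p 0 dvd x + y + p 1"
    and "\<And>i. 0 < i \<Longrightarrow> i < n - 3 \<Longrightarrow> p i dvd p (i - 1) + p (i + 1)"
    and "p (n - 3) = 1"
  shows "\<exists>S \<in> arithmetical_structures (bident n).
    order (critical_group (bident n) S) = nat (p 0 div (x * y))"
proof -
  obtain d r where S: "bident_structure n d r" "r V_x = x" "r V_y = y"
    "\<And>i. i \<le> n - 3 \<Longrightarrow> r (V_path i) = p i"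
    using bident_structureI[OF assms] by blast
  interpret bident_structure n d r by (rule S(1))
  have "K = p 0 div (x * y)"
    using S assms(9) by (simp add: K_def c_def l_def)
  then show ?thesis using arith order_critical_group by auto
qed

text \<open>The row of a vertex \<open>v\<close> equates \<open>d v * r v\<close> with a sum of
  entries of \<open>r\<close>, and \<open>r v\<close> is nonzero.\<close>

lemma arithmetical_structure_determined_by_r:
  assumes "finite (vertices G)" and "\<And>u. {u} \<notin> edges G"
    and "(d, r) \<in> arithmetical_structures G" "(d', r) \<in> arithmetical_structures G"
  shows "d = d'"
proof
  fix v
  show "d v = d' v"
  proof (cases "v \<in> vertices G")
    case True
    have "mat_vec (vertices G) (generalized_laplacian G e) r v = 0"
      if "(e, r) \<in> arithmetical_structures G" for e
      using that True by (auto simp: arithmetical_structures_def fun_eq_iff)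
    from this[OF assms(3)] this[OF assms(4)] have "d v * r v = d' v * r v"
      using True assms(1,2) by (simp add: mat_vec_generalized_laplacian)
    moreover have "r v > 0"
      using assms(3) True by (auto simp: arithmetical_structures_def)
    ultimately show ?thesis by simp
  next
    case False
    then show ?thesis
      using assms(3,4) by (auto simp: arithmetical_structures_def PiE_def extensional_def)
  qed
qed

lemma bident_maximal_order_exists:
  assumes "n \<ge> 4"
  shows "\<exists>S \<in> arithmetical_structures (bident n).
    order (critical_group (bident n) S) = 2 * n - 5"
proof -
  \<comment> \<open>The equality case of the path bound: leaves and end equal to 1, and steps of 2
    down the odd numbers from \<open>2 * n - 5\<close>.\<close>
  define p where "p i = 2 * (int (n - 3) - int i) + 1" for i
  have "\<exists>S \<in> arithmetical_structures (bident n).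
    order (critical_group (bident n) S) = nat (p 0 div (1 * 1))"
  proof (rule bident_order_exists)
    show "p i dvd p (i - 1) + p (i + 1)" if "0 < i" for i
    proof -
      have "p (i - 1) + p (i + 1) = p i * 2"
        using that by (simp add: p_def of_nat_diff)
      then show ?thesis by simp
    qed
  qed (use assms in \<open>auto simp: p_def\<close>)
  moreover have "nat (p 0 div (1 * 1)) = 2 * n - 5"
    using assms by (simp add: p_def of_nat_diff nat_eq_iff)
  ultimately show ?thesis by simp
qed

text \<open>Leaf values 1 and 2 give a path that descends from \<open>2 * K\<close> in steps of 3
  and stays at 1 once it would fall lower. The upper bound on \<open>K\<close> ensures that it
  reaches 1 by the last vertex.\<close>

lemma bident_even_order_exists:
  fixes K :: nat
  assumes "n \<ge> 4" and "K \<ge> 2" and "\<not> 3 dvd K" and "2 * K \<le> 3 * (n - 3) + 1"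
  shows "\<exists>S \<in> arithmetical_structures (bident n). order (critical_group (bident n) S) = K"
proof -
  define p where "p i = max 1 (2 * int K - 3 * int i)" for i
  have "\<exists>S \<in> arithmetical_structures (bident n).
    order (critical_group (bident n) S) = nat (p 0 div (1 * 2))"
  proof (rule bident_order_exists)
    have "p 0 = 2 * int K" "1 + 2 + p 1 = 2 * int K"
      using assms(2) by (auto simp: p_def)
    then show "p 0 dvd 1 + 2 + p 1" "2 dvd p 0"
      by simp_all
    show "p i dvd p (i - 1) + p (i + 1)" if "0 < i" for i
    proof -
      define s where "s = 2 * int K - 3 * int i"
      have p: "p i = max 1 s" "p (i - 1) = max 1 (s + 3)" "p (i + 1) = max 1 (s - 3)"
        using that by (auto simp: p_def s_def of_nat_diff)
      \<comment> \<open>A value 3 would have neighbours 6 and 1, whose sum it does not divide. A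
        value 2 has neighbours 5 and 1, which is harmless.\<close>
      have "s \<noteq> 3"
        using assms(3) unfolding s_def by presburger
      then consider "s \<le> 1" | "s = 2" | "s \<ge> 4" by linarith
      then show ?thesis
      proof cases
        case 3
        then have "p (i - 1) + p (i + 1) = p i * 2" unfolding p by simp
        then show ?thesis by simp
      qed (simp_all only: p, simp_all)
    qed
  qed (use assms in \<open>auto simp: p_def\<close>)
  moreover have "nat (p 0 div (1 * 2)) = K"
    using assms(2) by (simp add: p_def)
  ultimately show ?thesis by simp
qed

section \<open>Combining the bounds with the extremal structures\<close>

lemma bident_order_cases:
  assumes "n \<ge> 4" and "m \<in> critical_group_orders (bident n)"
  shows "m \<le> 2 * n - 5"
    and "even m \<Longrightarrow>
      m \<le> n - 2 \<or> 2 * m \<le> 1 + 3 * (n - 3) \<and> \<not> 3 dvd m \<or> 3 * m \<le> 1 + 4 * (n - 3)"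
proof -
  obtain d r where S: "(d, r) \<in> arithmetical_structures (bident n)"
    and m: "m = order (critical_group (bident n) (d, r))"
    using assms(2) by (auto simp: critical_group_orders_def)
  interpret bident_structure n d r
    using assms(1) S by unfold_locales
  have K: "K = int m"
    using m order_critical_group K_pos by simp
  show "m \<le> 2 * n - 5"
    using K_le assms(1) by (simp add: K l_def)
  assume "even m"
  then have "K \<le> 1 + int l \<or> 2 * K \<le> 1 + 3 * int l \<and> \<not> 3 dvd K \<or> 3 * K \<le> 1 + 4 * int l"
    using K by (intro even_K_bound) simp
  moreover have "3 dvd K \<longleftrightarrow> 3 dvd m"
    unfolding K by presburger
  ultimately show "m \<le> n - 2 \<or> 2 * m \<le> 1 + 3 * (n - 3) \<and> \<not> 3 dvd m \<or> 3 * m \<le> 1 + 4 * (n - 3)"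
    using assms(1) unfolding K l_def by linarith
qed

text \<open>The maximal order forces the leaf and end values to be 1, so \<open>c 0 = K\<close>
  attains the path bound. Its equality case fixes \<open>r\<close>, and \<open>r\<close> fixes
  \<open>d\<close>.\<close>

lemma bident_maximal_order_unique:
  assumes "n \<ge> 4"
    and "S \<in> arithmetical_structures (bident n)" "order (critical_group (bident n) S) = 2 * n - 5"
    and "S' \<in> arithmetical_structures (bident n)" "order (critical_group (bident n) S') = 2 * n - 5"
  shows "S = S'"
proof -
  have r_eq: "r v = (case v of V_x \<Rightarrow> 1 | V_y \<Rightarrow> 1 | V_path i \<Rightarrow> 1 + int (n - 3 - i) * 2)"
    if S: "(d, r) \<in> arithmetical_structures (bident n)"
      "order (critical_group (bident n) (d, r)) = 2 * n - 5"
      and v: "v \<in> vertices (bident n)" for d r v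
  proof -
    interpret bident_structure n d r
      using assms(1) S(1) by unfold_locales
    have K: "K = 2 * int l + 1"
      using S(2) order_critical_group K_pos assms(1) by (simp add: l_def nat_eq_iff of_nat_diff)
    then have one: "r V_x = 1" "r V_y = 1" "c l = 1"
      using K_maximal by auto
    then have "c 0 = c l + int l * (r V_x + r V_y)"
      using K K_eq by simp
    then have "c i = 1 + int (l - i) * 2" if "i \<le> l" for i
      using path_bound(2)[of i] that one by simp
    then show ?thesis
      using v one by (auto simp: V_eq c_def l_def)
  qed
  obtain d r d' r' where S: "S = (d, r)" "S' = (d', r')"
    by (metis surj_pair)
  have "r v = r' v" for v
  proof (cases "v \<in> vertices (bident n)")
    case True
    then show ?thesis using r_eq[of d r v] r_eq[of d' r' v] assms S by simp
  next
    case False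
    then show ?thesis
      using assms(2,4) S by (auto simp: arithmetical_structures_def PiE_def extensional_def)
  qed
  then have "r = r'" ..
  moreover have "d = d'"
    using arithmetical_structure_determined_by_r[OF finite_vertices_bident bident_no_loop]
      assms(2,4) S \<open>r = r'\<close> by blast
  ultimately show ?thesis using S by simp
qed

text \<open>Leaves only arithmetic in \<open>n\<close> and \<open>K\<close> to be checked for each
  residue of \<open>n\<close> modulo 4.\<close>

lemma bident_maximum_even_order:
  assumes "n \<ge> 4" and "K \<ge> 2" and "even K" and "\<not> 3 dvd K" and "2 * K \<le> 3 * (n - 3) + 1"
    and "\<And>m. even m \<Longrightarrow>
      m \<le> n - 2 \<or> 2 * m \<le> 1 + 3 * (n - 3) \<and> \<not> 3 dvd m \<or> 3 * m \<le> 1 + 4 * (n - 3) \<Longrightarrow> m \<le> K"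
  shows "is_maximum {m \<in> critical_group_orders (bident n). even m} K"
  using bident_even_order_exists[OF assms(1,2,4,5)] bident_order_cases(2)[OF assms(1)] assms(3,6)
  by (auto simp: is_maximum_def critical_group_orders_def)

theorem theorem5p8:
  fixes n :: nat
  assumes "n \<ge> 4"
  shows "(is_maximum (critical_group_orders (bident n)) (2 * n - 5) \<and>
          (\<exists>!S. S \<in> arithmetical_structures (bident n) \<and>
                order (critical_group (bident n) S) = 2 * n - 5)) \<and>
         (\<forall>k::nat.
            ((n = 4 * k \<or> n = 4 * k + 1) \<longrightarrow>
               is_maximum {m \<in> critical_group_orders (bident n). even m} (6 * k - 4)) \<and>
            ((n = 4 * k + 2 \<or> n = 4 * k + 3) \<longrightarrow>
               is_maximum {m \<in> critical_group_orders (bident n). even m} (6 * k - 2)))"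
proof (intro conjI allI impI)
  show "is_maximum (critical_group_orders (bident n)) (2 * n - 5)"
    using bident_maximal_order_exists[OF assms] bident_order_cases(1)[OF assms]
    unfolding is_maximum_def critical_group_orders_def by force
  show "\<exists>!S. S \<in> arithmetical_structures (bident n) \<and>
      order (critical_group (bident n) S) = 2 * n - 5"
    using bident_maximal_order_exists[OF assms] bident_maximal_order_unique[OF assms] by blast
next
  fix k :: nat
  assume n: "n = 4 * k \<or> n = 4 * k + 1"
  \<comment> \<open>\<open>n \<ge> 4\<close> excludes \<open>k = 0\<close>; the form
    \<open>Suc j\<close> removes the truncated subtractions.\<close>
  then obtain j where k: "k = Suc j"
    using assms by (cases k) auto
  show "is_maximum {m \<in> critical_group_orders (bident n). even m} (6 * k - 4)"
  proof (rule bident_maximum_even_order[OF assms])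
    show "6 * k - 4 \<ge> 2" "even (6 * k - 4)" "2 * (6 * k - 4) \<le> 3 * (n - 3) + 1"
      using n by (auto simp: k)
    show "\<not> 3 dvd 6 * k - 4"
      unfolding k by presburger
    show "m \<le> 6 * k - 4" if m: "even m"
      "m \<le> n - 2 \<or> 2 * m \<le> 1 + 3 * (n - 3) \<and> \<not> 3 dvd m \<or> 3 * m \<le> 1 + 4 * (n - 3)" for m
    proof -
      obtain q where q: "m = 2 * q" using m(1) by (elim evenE)
      have "q < 3 * j + 2" using m(2) n unfolding k q by auto
      then show ?thesis by (simp add: k q)
    qed
  qed
next
  fix k :: nat
  assume n: "n = 4 * k + 2 \<or> n = 4 * k + 3"
  then obtain j where k: "k = Suc j"
    using assms by (cases k) auto
  show "is_maximum {m \<in> critical_group_orders (bident n). even m} (6 * k - 2)"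
  proof (rule bident_maximum_even_order[OF assms])
    show "6 * k - 2 \<ge> 2" "even (6 * k - 2)" "2 * (6 * k - 2) \<le> 3 * (n - 3) + 1"
      using n by (auto simp: k)
    show "\<not> 3 dvd 6 * k - 2"
      unfolding k by presburger
    show "m \<le> 6 * k - 2" if m: "even m"
      "m \<le> n - 2 \<or> 2 * m \<le> 1 + 3 * (n - 3) \<and> \<not> 3 dvd m \<or> 3 * m \<le> 1 + 4 * (n - 3)" for m
    proof -
      obtain q where q: "m = 2 * q" using m(1) by (elim evenE)
      have "q \<le> 3 * j + 3" using m(2) n unfolding k q by auto
      \<comment> \<open>For \<open>n = 4 * k + 3\<close> the size bounds alone would admit
        \<open>m = 6 * k\<close>; only its divisibility by 3 rules it out.\<close>
      moreover have "q \<noteq> 3 * j + 3"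
      proof
        assume "q = 3 * j + 3"
        then have "m = 3 * (2 * j + 2)" by (simp add: q)
        moreover from this have "3 dvd m" by (rule dvdI)
        ultimately show False using m(2) n unfolding k by auto
      qed
      ultimately have "q < 3 * j + 3" by simp
      then show ?thesis by (simp add: k q)
    qed
  qed
qed

end
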